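(* Let $m,n\ge 1$ be integers and let $C\in\mathfrak{Cat}_{m,n}$ be a Catalan state such that $d^h(C)\le n$ and $d^v(C)\le m$. Then $C$ can be obtained as a Kauffman state of $L(m,n)$, i.e. there is a Kauffman state $s\in\mathcal S_{m,n}$ with $K(s)\approx C$.
   Context: $P$ is a rectangle with $2(m+n)$ marked boundary points: $n$ on the top side and $n$ on the bottom side (positions $1,\dots,n$ from left to right), and $m$ on the left side and $m$ on the right side (positions $1,\dots,m$ from top to bottom). A Catalan state is a crossingless connection of the marked points, i.e. a system of $m+n$ pairwise disjoint arcs in $P$ joining the marked points in pairs, up to isotopy fixing the boundary (denoted $\approx$); equivalently, a noncrossing perfect matching of the marked points. $\mathfrak{Cat}_{m,n}$ is the set of Catalan states. For $1\le i\le m-1$, $l_i^h$ is the horizontal line crossing $P$ between positions $i$ and $i+1$ on both the left and right sides; for $1\le i\le n-1$, $l_i^v$ is the vertical line crossing $P$ between positions $i$ and $i+1$ on both the top and bottom sides. $\#(l\cap C)$ is the minimal number of intersections of $l$ with $C$ (up to isotopy), i.e. the number of arcs of $C$ whose endpoints lie on different sides of $l$. Define $d^h(C)=\max\{\#(l_i^h\cap C): 1\le i\le m-1\}$ and $d^v(C)=\max\{\#(l_i^v\cap C): 1\le i\le n-1\}$, with the maximum of an empty set equal to $0$. The lattice crossing $L(m,n)$ is the tangle diagram in $P$ consisting of $m$ horizontal segments (joining position $i$ on the left to position $i$ on the right) and $n$ vertical segments (joining position $j$ on the top to position $j$ on the bottom), with $mn$ crossings. A Kauffman state $s\in\mathcal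 S_{m,n}$ is a choice of a positive or negative marker at every crossing; the crossing is smoothed accordingly in one of two ways: one marker joins its top end with its right end and its left end with its bottom end, the other joins its top end with its left end and its right end with its bottom end. $K(s)$ is the diagram obtained by smoothing all crossings according to $s$ and deleting all closed components. *)

theory Defs
  imports Main "HOL-Library.Disjoint_Sets" "HOL-Library.FuncSet"
begin

text \<open>
  Top and bottom positions are numbered from left to right, left and right positions
  from top to bottom, starting from 1.
\<close>

datatype point = Top nat | Bottom nat | Left nat | Right nat

definition marked_points :: "nat \<Rightarrow> nat \<Rightarrow> point set" where
  "marked_points m n = Top ` {1..n} \<union> Bottom ` {1..n} \<union> Left ` {1..m} \<union> Right ` {1..m}"

text \<open>
  Index of a marked point on the boundary of the rectangle, clockwise from the top left
  corner; it is a bijection from the marked points to \<open>{1..2 * (m + n)}\<close>.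
\<close>

fun boundary_index :: "nat \<Rightarrow> nat \<Rightarrow> point \<Rightarrow> nat" where
  "boundary_index m n (Top j) = j"
| "boundary_index m n (Right i) = n + i"
| "boundary_index m n (Bottom j) = n + m + (n + 1 - j)"
| "boundary_index m n (Left i) = 2 * n + m + (m + 1 - i)"

text \<open>
  A crossingless connection, up to isotopy fixing the boundary, is given by the set of
  the end point pairs of its arcs; so \<open>\<approx>\<close> becomes equality of such sets.
\<close>

definition crossing_arcs :: "nat \<Rightarrow> nat \<Rightarrow> point set \<Rightarrow> point set \<Rightarrow> bool" where
  "crossing_arcs m n e f \<longleftrightarrow>
     (\<exists>a b c d. e = {a, b} \<and> f = {c, d} \<and>
        boundary_index m n a < boundary_index m n c \<and>
        boundary_index m n c < boundary_index m n b \<and>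
        boundary_index m n b < boundary_index m n d)"

definition catalan_states :: "nat \<Rightarrow> nat \<Rightarrow> point set set set" where
  "catalan_states m n =
     {C. partition_on (marked_points m n) C \<and> (\<forall>e\<in>C. card e = 2) \<and>
         (\<forall>e\<in>C. \<forall>f\<in>C. \<not> crossing_arcs m n e f)}"

fun above_line :: "nat \<Rightarrow> point \<Rightarrow> bool" where
  "above_line i (Top j) \<longleftrightarrow> True"
| "above_line i (Bottom j) \<longleftrightarrow> False"
| "above_line i (Left k) \<longleftrightarrow> k \<le> i"
| "above_line i (Right k) \<longleftrightarrow> k \<le> i"

fun left_of_line :: "nat \<Rightarrow> point \<Rightarrow> bool" where
  "left_of_line i (Top k) \<longleftrightarrow> k \<le> i"
| "left_of_line i (Bottom k) \<longleftrightarrow> k \<le> i"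
| "left_of_line i (Left j) \<longleftrightarrow> True"
| "left_of_line i (Right j) \<longleftrightarrow> False"

text \<open>
  The number of intersections of a line with a Catalan state, where \<open>S\<close> tells the points
  on one side of the line from those on the other.
\<close>

definition intersections :: "(point \<Rightarrow> bool) \<Rightarrow> point set set \<Rightarrow> nat" where
  "intersections S C = card {e \<in> C. \<exists>p\<in>e. \<exists>q\<in>e. S p \<and> \<not> S q}"

text \<open>Inserting 0 only serves to make the maximum of an empty set 0.\<close>

definition d_h :: "nat \<Rightarrow> point set set \<Rightarrow> nat" where
  "d_h m C = Max (insert 0 ((\<lambda>i. intersections (above_line i) C) ` {1..m - 1}))"

definition d_v :: "nat \<Rightarrow> point set set \<Rightarrow> nat" where
  "d_v n C = Max (insert 0 ((\<lambda>i. intersections (left_of_line i) C) ` {1..n - 1}))"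

text \<open>
  The crossing \<open>(i, j)\<close> of \<open>L(m,n)\<close> lies on the \<open>i\<close>-th horizontal and the \<open>j\<close>-th vertical
  segment. The crossings cut the horizontal segment \<open>i\<close> into the strands
  \<open>Horizontal i 0, \<dots>, Horizontal i n\<close> from left to right, and the vertical segment \<open>j\<close>
  into \<open>Vertical 0 j, \<dots>, Vertical m j\<close> from top to bottom. Thus at the crossing \<open>(i, j)\<close>
  the left, right, top and bottom ends belong to \<open>Horizontal i (j - 1)\<close>,
  \<open>Horizontal i j\<close>, \<open>Vertical (i - 1) j\<close> and \<open>Vertical i j\<close>, respectively.
\<close>

datatype strand = Horizontal nat nat | Vertical nat nat

definition crossings :: "nat \<Rightarrow> nat \<Rightarrow> (nat \<times> nat) set" where
  "crossings m n = {1..m} \<times> {1..n}"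

datatype marker = Positive | Negative

definition kauffman_states :: "nat \<Rightarrow> nat \<Rightarrow> (nat \<times> nat \<Rightarrow> marker) set" where
  "kauffman_states m n = crossings m n \<rightarrow>\<^sub>E UNIV"

fun smoothing :: "marker \<Rightarrow> nat \<times> nat \<Rightarrow> (strand \<times> strand) set" where
  "smoothing Positive (i, j) =
     {(Vertical (i - 1) j, Horizontal i j), (Horizontal i (j - 1), Vertical i j)}"
| "smoothing Negative (i, j) =
     {(Vertical (i - 1) j, Horizontal i (j - 1)), (Horizontal i j, Vertical i j)}"

definition joined :: "nat \<Rightarrow> nat \<Rightarrow> (nat \<times> nat \<Rightarrow> marker) \<Rightarrow> (strand \<times> strand) set" where
  "joined m n s = (\<Union>x\<in>crossings m n. smoothing (s x) x)"

definition same_component :: "nat \<Rightarrow> nat \<Rightarrow> (nat \<times> nat \<Rightarrow> marker) \<Rightarrow> (strand \<times> strand) set" where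
  "same_component m n s = (joined m n s \<union> (joined m n s)\<inverse>)\<^sup>*"

fun end_strand :: "nat \<Rightarrow> nat \<Rightarrow> point \<Rightarrow> strand" where
  "end_strand m n (Top j) = Vertical 0 j"
| "end_strand m n (Bottom j) = Vertical m j"
| "end_strand m n (Left i) = Horizontal i 0"
| "end_strand m n (Right i) = Horizontal i n"

text \<open>
  \<open>K(s)\<close>, given by the end point pairs of its arcs. Closed components contain no marked
  point and so do not contribute.
\<close>

definition kauffman_diagram :: "nat \<Rightarrow> nat \<Rightarrow> (nat \<times> nat \<Rightarrow> marker) \<Rightarrow> point set set" where
  "kauffman_diagram m n s =
     {{p, q} | p q. p \<in> marked_points m n \<and> q \<in> marked_points m n \<and> p \<noteq> q \<and>
        (end_strand m n p, end_strand m n q) \<in> same_component m n s}"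

end

theory Submission
  imports Defs
begin

text \<open>
  Cut the rectangle by an \<open>m \<times> n\<close> grid of unit squares, one around each crossing. A Kauffman
  state crosses every grid edge exactly once, so it can be given by a map from the grid vertices to
  the dual tree of the arcs that takes adjacent vertices to adjacent nodes; the Catalan state
  prescribes this map on the boundary of the grid.
  A map into a tree extends if it is 1-Lipschitz (parities always match), and the tree distance of
  two boundary vertices is the number of arcs separating them. For vertices on opposite sides,
  \<open>d\<^sup>h(C) \<le> n\<close> and \<open>d\<^sup>v(C) \<le> m\<close> bound this number; otherwise it is
  bounded by the length of a path along the boundary.

  A node of the tree is given by the set of the arcs between it and the root, and the
  extension is explicit: a vertex \<open>v\<close> goes to the ancestor of the node of \<open>p\<close> at depth
  \<open>depth p - dist p v\<close>, where the boundary vertex \<open>p\<close> maximizes this number. The depth may be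
  negative; this extends the tree by a ray above the root, which carries closed components only.

  Given the extension, all grid edges crossed by a component map to the same edge of the tree. So
  an arc of the Kauffman state can only join the two end points of an arc of \<open>C\<close>.
\<close>

section \<open>Distances in the grid\<close>

definition grid_dist :: "nat \<times> nat \<Rightarrow> nat \<times> nat \<Rightarrow> int" where
  "grid_dist v w = \<bar>int (fst v) - int (fst w)\<bar> + \<bar>int (snd v) - int (snd w)\<bar>"

lemma grid_dist_commute: "grid_dist v w = grid_dist w v"
  by (simp add: grid_dist_def abs_minus_commute)

lemma grid_dist_triangle: "grid_dist u w \<le> grid_dist u v + grid_dist v w"
  by (simp add: grid_dist_def)

lemma even_grid_dist: "even (grid_dist v w) \<longleftrightarrow> even (fst v + snd v + fst w + snd w)"
proof -
  have "even (grid_dist v w) \<longleftrightarrow> even (int (fst v + snd v + fst w + snd w))"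
    unfolding grid_dist_def by (auto simp: abs_if)
  then show ?thesis
    by (simp only: even_of_nat_iff)
qed

section \<open>The dual tree of a noncrossing matching\<close>

locale noncrossing_matching =
  fixes X :: "'a set" and C :: "'a set set" and idx :: "'a \<Rightarrow> nat" and N :: nat
  assumes partition: "partition_on X C"
    and card_arc: "e \<in> C \<Longrightarrow> card e = 2"
    and bij_idx: "bij_betw idx X {1..N}"
    and noncrossing: "\<lbrakk>{a, b} \<in> C; {c, d} \<in> C; idx a < idx c; idx c < idx b\<rbrakk> \<Longrightarrow> \<not> idx b < idx d"
begin

text \<open>Here \<open>p\<close> from 0 to \<open>N\<close> stands for the boundary gap between the
  points with indices \<open>p\<close> and \<open>p + 1\<close>. The gaps 0 and \<open>N\<close>
  both lie at the root of the dual tree, and the set is the path from the root to the node at the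
  gap \<open>p\<close>.\<close>

definition arcs_over :: "nat \<Rightarrow> 'a set set" where
  "arcs_over p = {e \<in> C. \<exists>x\<in>e. \<exists>y\<in>e. idx x \<le> p \<and> p < idx y}"

definition depth :: "nat \<Rightarrow> int" where
  "depth p = int (card (arcs_over p))"

definition lo :: "'a set \<Rightarrow> nat" where
  "lo e = Min (idx ` e)"

definition hi :: "'a set \<Rightarrow> nat" where
  "hi e = Max (idx ` e)"

text \<open>The position of \<open>e\<close> on every root path that contains it. As
  \<open>e\<close> is over its own lower end, outermost arcs have level 1.\<close>

definition level :: "'a set \<Rightarrow> int" where
  "level e = depth (lo e)"

text \<open>For \<open>0 \<le> k \<le> depth p\<close>, the ancestor at depth \<open>k\<close> of
  the node at \<open>p\<close>. For negative \<open>k\<close> the set is empty, so nodes on the ray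
  above the root differ only in height.\<close>

definition outer_arcs :: "nat \<Rightarrow> int \<Rightarrow> 'a set set" where
  "outer_arcs p k = {e \<in> arcs_over p. level e \<le> k}"

text \<open>The tree distance between the nodes at the two gaps.\<close>

definition separation :: "nat \<Rightarrow> nat \<Rightarrow> int" where
  "separation p q = int (card (sym_diff (arcs_over p) (arcs_over q)))"

lemma inj_idx: "inj_on idx X"
  using bij_idx by (simp add: bij_betw_def)

lemma finite_C: "finite C"
proof -
  have "finite X"
    using bij_idx bij_betw_finite by blast
  moreover have "C \<subseteq> Pow X"
    using partition by (auto simp: partition_on_def)
  ultimately show ?thesis
    by (meson finite_Pow_iff finite_subset)
qed

lemma finite_arcs_over: "finite (arcs_over p)"
  using finite_C by (simp add: arcs_over_def)

lemma arc_ends: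
  assumes "e \<in> C"
  obtains a b where "e = {a, b}" "a \<in> X" "b \<in> X" "idx a < idx b" "lo e = idx a" "hi e = idx b"
proof -
  obtain a b where ab: "e = {a, b}" "a \<noteq> b"
    using card_arc[OF assms] by (auto simp: card_2_iff)
  have X: "a \<in> X" "b \<in> X"
    using assms ab partition by (auto simp: partition_on_def)
  then have "idx a \<noteq> idx b"
    using ab inj_idx by (auto simp: inj_on_def)
  then consider "idx a < idx b" | "idx b < idx a" by linarith
  then show ?thesis
  proof cases
    case 1
    then show ?thesis
      using that[of a b] X ab by (simp add: lo_def hi_def)
  next
    case 2
    then show ?thesis
      using that[of b a] X ab by (simp add: lo_def hi_def insert_commute)
  qed
qed

lemma arc_unique: "\<lbrakk>e \<in> C; f \<in> C; x \<in> e; x \<in> f\<rbrakk> \<Longrightarrow> e = f"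
  using partition by (auto simp: partition_on_def disjoint_def)

lemma mem_arcs_over:
  assumes "e \<in> C"
  shows "e \<in> arcs_over p \<longleftrightarrow> lo e \<le> p \<and> p < hi e"
proof -
  obtain a b where ab: "e = {a, b}" "a \<in> X" "b \<in> X" "idx a < idx b" "lo e = idx a" "hi e = idx b"
    using assms by (rule arc_ends)
  have "e \<in> arcs_over p \<longleftrightarrow> (\<exists>x\<in>{a, b}. \<exists>y\<in>{a, b}. idx x \<le> p \<and> p < idx y)"
    using assms ab(1) by (simp add: arcs_over_def)
  also have "\<dots> \<longleftrightarrow> idx a \<le> p \<and> p < idx b"
    using ab(4) by auto
  finally show ?thesis
    by (simp only: ab(5,6))
qed

lemma arc_bounds:
  assumes "e \<in> C"
  shows "1 \<le> lo e" "hi e \<le> N"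
proof -
  obtain a b where "e = {a, b}" "a \<in> X" "b \<in> X" "idx a < idx b" "lo e = idx a" "hi e = idx b"
    using assms by (rule arc_ends)
  moreover from this have "idx a \<in> {1..N}" "idx b \<in> {1..N}"
    using bij_betwE[OF bij_idx] by blast+
  ultimately show "1 \<le> lo e" "hi e \<le> N"
    by simp_all
qed

lemma arcs_over_subset: "arcs_over p \<subseteq> C"
  by (auto simp: arcs_over_def)

lemma arcs_over_0: "arcs_over 0 = {}"
proof (rule equals0I)
  fix e assume e: "e \<in> arcs_over 0"
  then have "e \<in> C"
    using arcs_over_subset by auto
  then show False
    using e arc_bounds(1)[of e] by (simp add: mem_arcs_over)
qed

lemma arcs_over_N: "arcs_over N = {}"
proof (rule equals0I)
  fix e assume e: "e \<in> arcs_over N"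
  then have "e \<in> C"
    using arcs_over_subset by auto
  then show False
    using e arc_bounds(2)[of e] by (simp add: mem_arcs_over)
qed

text \<open>An arc separates two gaps iff exactly one of its end points lies between them on the
  boundary.\<close>

lemma sym_diff_arcs_over:
  assumes "p \<le> q"
  shows "sym_diff (arcs_over p) (arcs_over q)
    = {e \<in> C. \<exists>x\<in>e. \<exists>y\<in>e. p < idx x \<and> idx x \<le> q \<and> \<not> (p < idx y \<and> idx y \<le> q)}"
    (is "_ = ?R")
proof -
  have "e \<in> sym_diff (arcs_over p) (arcs_over q) \<longleftrightarrow> e \<in> ?R" if e: "e \<in> C" for e
  proof -
    obtain a b where ab: "e = {a, b}" "a \<in> X" "b \<in> X" "idx a < idx b" "lo e = idx a" "hi e = idx b"
      using e by (rule arc_ends)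
    have "e \<in> ?R \<longleftrightarrow> (p < idx a \<and> idx a \<le> q) \<noteq> (p < idx b \<and> idx b \<le> q)"
      using e unfolding ab(1) by auto
    also have "\<dots> \<longleftrightarrow> e \<in> sym_diff (arcs_over p) (arcs_over q)"
      using assms ab(4) unfolding Un_iff Diff_iff mem_arcs_over[OF e] ab(5,6)
      by linarith
    finally show ?thesis by simp
  qed
  moreover have "sym_diff (arcs_over p) (arcs_over q) \<subseteq> C"
    using arcs_over_subset by blast
  ultimately show ?thesis by blast
qed

text \<open>Passing a marked point crosses only the arc that ends there. This makes neighbouring
  gaps adjacent in the tree and later identifies the labels of boundary strands.\<close>

lemma sym_diff_arcs_over_idx:
  assumes "e \<in> C" "x \<in> e"
  shows "sym_diff (arcs_over (idx x - 1)) (arcs_over (idx x)) = {e}"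
proof -
  have xX: "x \<in> X"
    using assms partition by (auto simp: partition_on_def)
  then have pos: "idx x \<ge> 1"
    using bij_idx by (auto simp: bij_betw_def)
  have "f \<in> sym_diff (arcs_over (idx x - 1)) (arcs_over (idx x)) \<longleftrightarrow> f = e" if f: "f \<in> C" for f
  proof -
    obtain a b where ab: "f = {a, b}" "a \<in> X" "b \<in> X" "idx a < idx b" "lo f = idx a" "hi f = idx b"
      using f by (rule arc_ends)
    have "f \<in> sym_diff (arcs_over (idx x - 1)) (arcs_over (idx x)) \<longleftrightarrow> idx a = idx x \<or> idx b = idx x"
      using pos ab(4) unfolding Un_iff Diff_iff mem_arcs_over[OF f] ab(5,6)
      by linarith
    also have "\<dots> \<longleftrightarrow> x \<in> f"
      using ab(1-3) xX inj_idx by (auto simp: inj_on_def)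
    also have "\<dots> \<longleftrightarrow> f = e"
      using arc_unique[of f e x] f assms by auto
    finally show ?thesis .
  qed
  moreover have "sym_diff (arcs_over (idx x - 1)) (arcs_over (idx x)) \<subseteq> C"
    using arcs_over_subset by blast
  ultimately show ?thesis
    using assms by blast
qed

lemma separation_commute: "separation p q = separation q p"
  by (simp add: separation_def Un_commute)

lemma separation_triangle: "separation p r \<le> separation p q + separation q r"
proof -
  let ?D = "\<lambda>p q. sym_diff (arcs_over p) (arcs_over q)"
  have "card (?D p r) \<le> card (?D p q \<union> ?D q r)"
    by (intro card_mono) (auto simp: finite_arcs_over)
  also have "\<dots> \<le> card (?D p q) + card (?D q r)"
    by (rule card_Un_le)
  finally show ?thesis
    unfolding separation_def by linarith
qed

text \<open>The intersection is the root path of the lowest common ancestor, so this is the usual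
  formula for tree distance in terms of depths.\<close>

lemma separation_eq:
  "separation p q = depth p + depth q - 2 * int (card (arcs_over p \<inter> arcs_over q))"
proof -
  let ?A = "arcs_over p" and ?B = "arcs_over q"
  have fin: "finite ?A" "finite ?B"
    by (auto simp: finite_arcs_over)
  have "card (sym_diff ?A ?B) = card (?A - ?B) + card (?B - ?A)"
    using fin by (intro card_Un_disjoint) auto
  moreover have "card ?A = card (?A - ?B) + card (?A \<inter> ?B)"
    using fin by (metis Diff_Diff_Int card_Diff_subset_Int card_Int_Diff add.commute)
  moreover have "card ?B = card (?B - ?A) + card (?A \<inter> ?B)"
    using fin by (metis Int_commute card_Int_Diff add.commute)
  ultimately show ?thesis
    by (simp add: separation_def depth_def)
qed

lemma separation_Suc:
  assumes "p < N"
  shows "separation p (Suc p) = 1"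
proof -
  have "Suc p \<in> idx ` X"
    using assms bij_idx by (auto simp: bij_betw_def)
  then obtain x where "x \<in> X" "idx x = Suc p" by auto
  moreover then obtain e where "e \<in> C" "x \<in> e"
    using partition by (auto simp: partition_on_def)
  ultimately show ?thesis
    using sym_diff_arcs_over_idx[of e x] by (simp add: separation_def)
qed

lemma separation_self [simp]: "separation p p = 0"
  by (simp add: separation_def)

lemma separation_le:
  assumes "p \<le> q" "q \<le> N"
  shows "separation p q \<le> int q - int p"
  using assms
proof (induction q rule: dec_induct)
  case (step k)
  then show ?case
    using separation_triangle[of p "Suc k" k] separation_Suc[of k] by linarith
qed simp

lemma separation_le_abs:
  assumes "p \<le> N" "q \<le> N"
  shows "separation p q \<le> \<bar>int p - int q\<bar>"
proof (cases "p \<le> q")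
  case True
  then show ?thesis
    using separation_le[of p q] assms by simp
next
  case False
  then show ?thesis
    using separation_le[of q p] separation_commute[of p q] assms by simp
qed

text \<open>Links tree distance to \<open>intersections\<close>: a line of the rectangle cuts the
  boundary at two gaps, and one of its sides consists of the points between them.\<close>

lemma separation_line:
  assumes "p \<le> q" and S: "\<And>x. x \<in> X \<Longrightarrow> S x \<longleftrightarrow> \<not> (p < idx x \<and> idx x \<le> q)"
  shows "separation p q = int (card {e \<in> C. \<exists>x\<in>e. \<exists>y\<in>e. S x \<and> \<not> S y})"
proof -
  have "(\<exists>x\<in>e. \<exists>y\<in>e. p < idx x \<and> idx x \<le> q \<and> \<not> (p < idx y \<and> idx y \<le> q))
      \<longleftrightarrow> (\<exists>x\<in>e. \<exists>y\<in>e. S x \<and> \<not> S y)" if "e \<in> C" for e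
  proof -
    have X: "x \<in> X" if "x \<in> e" for x
      using that \<open>e \<in> C\<close> partition by (auto simp: partition_on_def)
    have "(\<exists>x\<in>e. \<exists>y\<in>e. p < idx x \<and> idx x \<le> q \<and> \<not> (p < idx y \<and> idx y \<le> q))
        \<longleftrightarrow> (\<exists>x\<in>e. \<exists>y\<in>e. \<not> S x \<and> S y)"
      using S[OF X] by (intro bex_cong refl) simp
    then show ?thesis
      by blast
  qed
  then show ?thesis
    unfolding separation_def sym_diff_arcs_over[OF assms(1)]
    by (intro arg_cong[where f = "\<lambda>A. int (card A)"] Collect_cong conj_cong refl)
qed

lemma separation_N: "separation 0 N = 0"
  by (simp add: separation_def arcs_over_0 arcs_over_N)

lemma even_depth:
  assumes "p \<le> N"
  shows "even (depth p) \<longleftrightarrow> even p"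
  using assms
proof (induction p)
  case 0
  then show ?case
    by (simp add: depth_def arcs_over_0)
next
  case (Suc p)
  have "depth (Suc p) + depth p = 1 + 2 * int (card (arcs_over p \<inter> arcs_over (Suc p)))"
    using separation_eq[of p "Suc p"] separation_Suc[of p] Suc.prems by simp
  then have "odd (depth (Suc p) + depth p)"
    by simp
  then show ?case
    using Suc by auto
qed

lemma arcs_over_chain:
  assumes "e \<in> arcs_over p" "f \<in> arcs_over p"
  shows "f \<in> arcs_over (lo e) \<or> e \<in> arcs_over (lo f)"
proof -
  have "e \<in> C" "f \<in> C"
    using assms arcs_over_subset by auto
  then show ?thesis
    using assms by (auto simp: mem_arcs_over)
qed

text \<open>By noncrossing, an arc that is open where \<open>f\<close> begins cannot end before
  \<open>f\<close> does. So the arcs over a gap form a set closed under passing to enclosing arcs,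
  as a root path must be.\<close>

lemma arcs_over_nested:
  assumes "f \<in> C" "e \<in> arcs_over (lo f)" "f \<in> arcs_over q"
  shows "e \<in> arcs_over q"
proof -
  have "e \<in> C"
    using assms arcs_over_subset by auto
  obtain a b where ab: "e = {a, b}" "a \<in> X" "b \<in> X" "idx a < idx b" "lo e = idx a" "hi e = idx b"
    using \<open>e \<in> C\<close> by (rule arc_ends)
  obtain c d where cd: "f = {c, d}" "c \<in> X" "d \<in> X" "idx c < idx d" "lo f = idx c" "hi f = idx d"
    using \<open>f \<in> C\<close> by (rule arc_ends)
  have le: "lo e \<le> lo f" "lo f < hi e" "lo f \<le> q" "q < hi f"
    using assms \<open>e \<in> C\<close> by (auto simp: mem_arcs_over)
  show ?thesis
  proof (cases "lo e = lo f")
    case True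
    then have "a = c"
      using ab(2,5) cd(2,5) inj_idx by (auto simp: inj_on_def)
    then have "e = f"
      using arc_unique[of e f a] ab(1) cd(1) \<open>e \<in> C\<close> assms(1) by auto
    then show ?thesis
      using assms by simp
  next
    case False
    then have "\<not> hi e < hi f"
      using noncrossing[of a b c d] ab(1,5,6) cd(1,5,6) le(1,2) \<open>e \<in> C\<close> assms(1) by simp
    then show ?thesis
      using le \<open>e \<in> C\<close> by (simp add: mem_arcs_over)
  qed
qed

lemma arcs_over_lo_self: "e \<in> C \<Longrightarrow> e \<in> arcs_over (lo e)"
  by (metis arc_ends mem_arcs_over order_refl)

lemma level_le_depth:
  assumes "e \<in> arcs_over p"
  shows "level e \<le> depth p"
proof -
  have "arcs_over (lo e) \<subseteq> arcs_over p"
    using assms arcs_over_nested[of e _ p] by (auto simp: arcs_over_def)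
  then show ?thesis
    using finite_arcs_over by (simp add: level_def depth_def card_mono)
qed

lemma outer_arcs_depth: "outer_arcs p (depth p) = arcs_over p"
  using level_le_depth by (auto simp: outer_arcs_def)

text \<open>An arc over \<open>p\<close> but not over \<open>q\<close> lies strictly inside every
  arc over both, since the opposite nesting would put it over \<open>q\<close> too. Its level
  therefore exceeds the depth of the lowest common ancestor.\<close>

lemma outer_arcs_subset:
  assumes "k \<le> int (card (arcs_over p \<inter> arcs_over q))"
  shows "outer_arcs p k \<subseteq> outer_arcs q k"
proof
  fix e assume e: "e \<in> outer_arcs p k"
  then have eC: "e \<in> C" and ep: "e \<in> arcs_over p" and lev: "level e \<le> k"
    by (auto simp: outer_arcs_def arcs_over_def)
  have "e \<in> arcs_over q"
  proof (rule ccontr)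
    assume neq: "e \<notin> arcs_over q"
    have "arcs_over p \<inter> arcs_over q \<subseteq> arcs_over (lo e) - {e}"
    proof
      fix f assume f: "f \<in> arcs_over p \<inter> arcs_over q"
      then have "f \<in> C" by (auto simp: arcs_over_def)
      then have "e \<notin> arcs_over (lo f)"
        using arcs_over_nested f neq by blast
      then show "f \<in> arcs_over (lo e) - {e}"
        using arcs_over_chain[OF ep, of f] f neq by auto
    qed
    also have "\<dots> \<subset> arcs_over (lo e)"
      using arcs_over_lo_self[OF eC] by auto
    finally have "int (card (arcs_over p \<inter> arcs_over q)) < level e"
      using finite_arcs_over by (simp add: level_def depth_def psubset_card_mono)
    then show False
      using assms lev by simp
  qed
  then show "e \<in> outer_arcs q k"
    using lev by (simp add: outer_arcs_def)
qed

lemma outer_arcs_eq: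
  assumes "k \<le> int (card (arcs_over p \<inter> arcs_over q))"
  shows "outer_arcs p k = outer_arcs q k"
  using outer_arcs_subset[of k p q] outer_arcs_subset[of k q p] assms
  by (auto simp: Int_commute)

end

section \<open>Extension of a 1-Lipschitz boundary map to the grid\<close>

text \<open>\<open>pos p\<close> is the grid vertex at the gap \<open>p\<close>. The parity
  condition will force the heights of adjacent vertices to differ.\<close>

locale lipschitz_boundary = noncrossing_matching +
  fixes pos :: "nat \<Rightarrow> nat \<times> nat"
  assumes separation_le_dist: "p \<le> N \<Longrightarrow> q \<le> N \<Longrightarrow> separation p q \<le> grid_dist (pos p) (pos q)"
    and even_pos: "p \<le> N \<Longrightarrow> even (p + fst (pos p) + snd (pos p))"
begin

text \<open>The least 1-Lipschitz extension (McShane) of the depth on the boundary.\<close>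

definition height :: "nat \<times> nat \<Rightarrow> int" where
  "height v = Max ((\<lambda>p. depth p - grid_dist (pos p) v) ` {..N})"

text \<open>The union over all maximizers avoids choosing one; they all contribute the same
  set.\<close>

definition region :: "nat \<times> nat \<Rightarrow> 'a set set" where
  "region v = (\<Union>p\<in>{p. p \<le> N \<and> depth p - grid_dist (pos p) v = height v}. outer_arcs p (height v))"

lemma height_ge: "p \<le> N \<Longrightarrow> depth p - grid_dist (pos p) v \<le> height v"
  unfolding height_def by (intro Max_ge) auto

lemma height_attained:
  obtains p where "p \<le> N" "depth p - grid_dist (pos p) v = height v"
proof -
  have "height v \<in> (\<lambda>p. depth p - grid_dist (pos p) v) ` {..N}"
    unfolding height_def by (intro Max_in) auto
  then show ?thesis
    by (rule imageE) (rule that, simp_all)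
qed

text \<open>If \<open>p\<close> and \<open>q\<close> both attain the maximum, the Lipschitz
  condition gives \<open>separation q p \<le> depth q + depth p - 2 * height v\<close>. So
  \<open>height v\<close> is at most the depth of their lowest common ancestor, and their ancestors
  at that height agree.\<close>

lemma region_eq:
  assumes p: "p \<le> N" "depth p - grid_dist (pos p) v = height v"
  shows "region v = outer_arcs p (height v)"
proof -
  have "outer_arcs q (height v) = outer_arcs p (height v)"
    if q: "q \<le> N" "depth q - grid_dist (pos q) v = height v" for q
  proof (rule outer_arcs_eq)
    have "separation q p \<le> grid_dist (pos q) v + grid_dist (pos p) v"
      using separation_le_dist[OF q(1) p(1)] grid_dist_triangle[of "pos q" "pos p" v]
      unfolding grid_dist_commute[of v "pos p"] by linarith
    then show "height v \<le> int (card (arcs_over q \<inter> arcs_over p))"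
      using separation_eq[of q p] p(2) q(2) by linarith
  qed
  then have "region v = (\<Union>q\<in>{q. q \<le> N \<and> depth q - grid_dist (pos q) v = height v}.
      outer_arcs p (height v))"
    unfolding region_def by (intro SUP_cong) auto
  then show ?thesis
    using p by auto
qed

lemma even_height: "even (height v) \<longleftrightarrow> even (fst v + snd v)"
proof -
  obtain p where p: "p \<le> N" "depth p - grid_dist (pos p) v = height v"
    by (rule height_attained)
  have "even (height v) \<longleftrightarrow> even (depth p) = even (grid_dist (pos p) v)"
    unfolding p(2)[symmetric] by simp
  also have "\<dots> \<longleftrightarrow> even (fst v + snd v)"
    using even_pos[OF p(1)] unfolding even_depth[OF p(1)] even_grid_dist even_add by blast
  finally show ?thesis .
qed

lemma height_le:
  assumes "grid_dist v w = 1"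
  shows "height w \<le> height v + 1"
proof -
  obtain p where "p \<le> N" "depth p - grid_dist (pos p) w = height w"
    by (rule height_attained)
  moreover have "grid_dist (pos p) v \<le> grid_dist (pos p) w + grid_dist v w"
    using grid_dist_triangle[of "pos p" v w] by (simp only: grid_dist_commute[of v w])
  ultimately show ?thesis
    using height_ge[of p v] assms by linarith
qed

lemma height_adjacent:
  assumes "grid_dist v w = 1"
  shows "height w = height v + 1 \<or> height v = height w + 1"
proof -
  have "odd (fst v + snd v + (fst w + snd w))"
    using even_grid_dist[of v w] assms by (simp add: add.assoc)
  then have "height v \<noteq> height w"
    using even_height[of v] even_height[of w] by auto
  then show ?thesis
    using height_le[of v w] height_le[of w v] assms by (auto simp: grid_dist_commute)
qed

text \<open>A maximizer for the higher vertex \<open>w\<close> is one for \<open>v\<close> too, as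
  its value drops by at most 1 on moving to \<open>v\<close>. Both regions are thus cut from the
  same root path.\<close>

lemma region_parent:
  assumes "grid_dist v w = 1" "height w = height v + 1"
  shows "region v = {e \<in> region w. level e \<le> height v}"
proof -
  obtain p where p: "p \<le> N" "depth p - grid_dist (pos p) w = height w"
    by (rule height_attained)
  have "grid_dist (pos p) v \<le> grid_dist (pos p) w + grid_dist v w"
    using grid_dist_triangle[of "pos p" v w] by (simp only: grid_dist_commute[of v w])
  then have "depth p - grid_dist (pos p) v = height v"
    using height_ge[OF p(1), of v] assms p(2) by linarith
  then have "region v = outer_arcs p (height v)"
    using p(1) by (intro region_eq)
  moreover have "region w = outer_arcs p (height v + 1)"
    using region_eq[OF p] assms(2) by simp
  ultimately show ?thesis
    by (auto simp: outer_arcs_def)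
qed

lemma region_eq_parent:
  assumes "grid_dist v w = 1" "grid_dist w v' = 1" "height w = height v + 1" "height w = height v' + 1"
  shows "region v = region v'"
proof -
  have "grid_dist v' w = 1"
    using assms(2) grid_dist_commute[of w v'] by (simp only:)
  then have "region v' = {e \<in> region w. level e \<le> height v'}"
    using assms(4) by (rule region_parent)
  moreover have "height v' = height v"
    using assms(3,4) by linarith
  ultimately show ?thesis
    using region_parent[OF assms(1,3)] by (simp only:)
qed

text \<open>
  The regions are nodes of a tree, and a closed walk of length 4 in a tree backtracks.
\<close>

lemma region_square:
  assumes "grid_dist a b = 1" "grid_dist b c = 1" "grid_dist c d = 1" "grid_dist d a = 1"
  shows "region a = region c \<or> region b = region d"
proof -
  have adj: "height b = height a + 1 \<or> height a = height b + 1"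
    "height c = height b + 1 \<or> height b = height c + 1"
    "height d = height c + 1 \<or> height c = height d + 1"
    "height a = height d + 1 \<or> height d = height a + 1"
    using assms by (simp_all add: height_adjacent)
  \<comment> \<open>A highest corner of the square exceeds both its neighbours by 1, so both of them
    map to its parent.\<close>
  then consider "height b = height a + 1" "height b = height c + 1"
    | "height d = height a + 1" "height d = height c + 1"
    | "height a = height b + 1" "height a = height d + 1"
    | "height c = height b + 1" "height c = height d + 1"
    by fastforce
  then show ?thesis
  proof cases
    case 1
    then show ?thesis
      using region_eq_parent[OF assms(1,2)] by blast
  next
    case 2
    then show ?thesis
      using region_eq_parent[OF assms(3,4)] by metis
  next
    case 3
    then show ?thesis
      using region_eq_parent[OF assms(4,1)] by metis
  next
    case 4
    then show ?thesis
      using region_eq_parent[OF assms(2,3)] by blast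
  qed
qed

text \<open>Depths differ by at most the tree distance, hence by at most the grid distance. So no
  boundary vertex beats \<open>p\<close> at its own position.\<close>

lemma region_pos:
  assumes "p \<le> N"
  shows "region (pos p) = arcs_over p"
proof -
  have "height (pos p) \<le> depth p"
  proof -
    obtain q where q: "q \<le> N" "depth q - grid_dist (pos q) (pos p) = height (pos p)"
      by (rule height_attained)
    have "card (arcs_over q \<inter> arcs_over p) \<le> card (arcs_over p)"
      by (simp add: card_mono finite_arcs_over)
    then have "depth q - depth p \<le> separation q p"
      using separation_eq[of q p] by (simp add: depth_def)
    then show ?thesis
      using separation_le_dist[of q p] q assms by simp
  qed
  then have "height (pos p) = depth p"
    using height_ge[of p "pos p"] assms by (simp add: grid_dist_def)
  then show ?thesis
    using region_eq[of p "pos p"] assms outer_arcs_depth by (simp add: grid_dist_def)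
qed

end

section \<open>Parity of the number of end points of components\<close>

lemma even_telescope:
  fixes f :: "nat \<Rightarrow> nat"
  shows "even ((\<Sum>i=1..k. f (i - 1) + f i) + f 0 + f k)"
  by (induction k) auto

lemma mem_marked_points [simp]:
  "Top j \<in> marked_points m n \<longleftrightarrow> j \<in> {1..n}"
  "Bottom j \<in> marked_points m n \<longleftrightarrow> j \<in> {1..n}"
  "Left i \<in> marked_points m n \<longleftrightarrow> i \<in> {1..m}"
  "Right i \<in> marked_points m n \<longleftrightarrow> i \<in> {1..m}"
  by (auto simp: marked_points_def)

text \<open>Every strand has two ends, each at a crossing or at a marked point. A crossing joins its
  four ends in pairs, so an even number of them belongs to \<open>K\<close>; hence so does an even
  number of the ends at marked points.\<close>

lemma even_card_ends:
  assumes closed: "\<And>x y. (x, y) \<in> joined m n s \<Longrightarrow> x \<in> K \<longleftrightarrow> y \<in> K"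
  shows "even (card {p \<in> marked_points m n. end_strand m n p \<in> K})"
proof -
  define \<chi> :: "strand \<Rightarrow> nat" where "\<chi> x = (if x \<in> K then 1 else 0)" for x
  define v where "v i j = \<chi> (Vertical i j)" for i j
  define h where "h i j = \<chi> (Horizontal i j)" for i j
  define A where "A j = (\<Sum>i=1..m. v (i - 1) j + v i j)" for j
  define B where "B i = (\<Sum>j=1..n. h i (j - 1) + h i j)" for i
  have fin: "finite (marked_points m n)"
    by (simp add: marked_points_def)
  have square: "even ((v (i - 1) j + v i j) + (h i (j - 1) + h i j))"
    if "i \<in> {1..m}" "j \<in> {1..n}" for i j
  proof -
    have "smoothing (s (i, j)) (i, j) \<subseteq> joined m n s"
      using that unfolding joined_def crossings_def by (intro UN_upper) simp
    then show ?thesis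
      using closed by (cases "s (i, j)") (auto simp: v_def h_def \<chi>_def)
  qed
  have "even (\<Sum>i=1..m. \<Sum>j=1..n. (v (i - 1) j + v i j) + (h i (j - 1) + h i j))"
    using square by (intro dvd_sum) auto
  also have "(\<Sum>i=1..m. \<Sum>j=1..n. (v (i - 1) j + v i j) + (h i (j - 1) + h i j))
      = (\<Sum>i=1..m. \<Sum>j=1..n. v (i - 1) j + v i j) + (\<Sum>i=1..m. \<Sum>j=1..n. h i (j - 1) + h i j)"
    by (simp only: sum.distrib)
  \<comment> \<open>Vertical strands have to be summed along columns to telescope, horizontal ones
    along rows.\<close>
  also have "(\<Sum>i=1..m. \<Sum>j=1..n. v (i - 1) j + v i j) = (\<Sum>j=1..n. \<Sum>i=1..m. v (i - 1) j + v i j)"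
    by (rule sum.swap)
  finally have "even ((\<Sum>j=1..n. A j) + (\<Sum>i=1..m. B i))"
    by (simp only: A_def B_def)
  moreover have "even (\<Sum>j=1..n. A j + v 0 j + v m j)"
    unfolding A_def by (intro dvd_sum even_telescope)
  moreover have "even (\<Sum>i=1..m. B i + h i 0 + h i n)"
    unfolding B_def by (intro dvd_sum even_telescope)
  ultimately have "even ((\<Sum>j=1..n. v 0 j) + (\<Sum>j=1..n. v m j)
      + ((\<Sum>i=1..m. h i 0) + (\<Sum>i=1..m. h i n)))"
    unfolding sum.distrib by presburger
  also have "(\<Sum>j=1..n. v 0 j) + (\<Sum>j=1..n. v m j) + ((\<Sum>i=1..m. h i 0) + (\<Sum>i=1..m. h i n))
      = (\<Sum>p\<in>marked_points m n. \<chi> (end_strand m n p))"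
  proof -
    have disj: "Top ` A \<inter> Bottom ` B = {}" "Top ` A \<inter> Left ` B = {}" "Top ` A \<inter> Right ` B = {}"
      "Bottom ` A \<inter> Left ` B = {}" "Bottom ` A \<inter> Right ` B = {}" "Left ` A \<inter> Right ` B = {}"
      for A B by auto
    let ?g = "\<lambda>p. \<chi> (end_strand m n p)"
    have "sum ?g (marked_points m n) = sum ?g (Top ` {1..n}) + sum ?g (Bottom ` {1..n})
        + sum ?g (Left ` {1..m}) + sum ?g (Right ` {1..m})"
      unfolding marked_points_def
      by (simp add: sum.union_disjoint Int_Un_distrib2 disj)
    then show ?thesis
      by (simp add: sum.reindex inj_on_def v_def h_def)
  qed
  also have "\<dots> = card {p \<in> marked_points m n. end_strand m n p \<in> K}"
    unfolding \<chi>_def card_eq_sum using fin by (rule sum.inter_filter[symmetric])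
  finally show ?thesis .
qed

section \<open>The boundary of the rectangle and its Lipschitz condition\<close>

lemma bij_betw_boundary_index:
  "bij_betw (boundary_index m n) (marked_points m n) {1..2 * (m + n)}"
proof -
  have "inj_on (boundary_index m n) (marked_points m n)"
    by (auto simp: inj_on_def marked_points_def)
  moreover have "boundary_index m n ` marked_points m n = {1..2 * (m + n)}"
  proof (intro equalityI subsetI)
    fix k assume k: "k \<in> {1..2 * (m + n)}"
    consider "k \<le> n" | "n < k" "k \<le> n + m" | "n + m < k" "k \<le> 2 * n + m" | "2 * n + m < k"
      by linarith
    then show "k \<in> boundary_index m n ` marked_points m n"
    proof cases
      case 1
      then show ?thesis
        using k by (intro image_eqI[of _ _ "Top k"]) simp_all
    next
      case 2
      then show ?thesis
        by (intro image_eqI[of _ _ "Right (k - n)"]) auto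
    next
      case 3
      then show ?thesis
        by (intro image_eqI[of _ _ "Bottom (2 * n + m + 1 - k)"]) auto
    next
      case 4
      then show ?thesis
        using k by (intro image_eqI[of _ _ "Left (2 * n + 2 * m + 1 - k)"]) auto
    qed
  qed (auto simp: marked_points_def)
  ultimately show ?thesis
    by (simp add: bij_betw_def)
qed

lemma catalan_noncrossing_matching:
  assumes "C \<in> catalan_states m n"
  shows "noncrossing_matching (marked_points m n) C (boundary_index m n) (2 * (m + n))"
proof
  show "partition_on (marked_points m n) C" "\<And>e. e \<in> C \<Longrightarrow> card e = 2"
    using assms by (auto simp: catalan_states_def)
  show "bij_betw (boundary_index m n) (marked_points m n) {1..2 * (m + n)}"
    by (rule bij_betw_boundary_index)
next
  fix a b c d
  assume *: "{a, b} \<in> C" "{c, d} \<in> C" "boundary_index m n a < boundary_index m n c"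
    "boundary_index m n c < boundary_index m n b"
  then have "\<not> crossing_arcs m n {a, b} {c, d}"
    using assms by (auto simp: catalan_states_def)
  then show "\<not> boundary_index m n b < boundary_index m n d"
    using * unfolding crossing_arcs_def by blast
qed

text \<open>The clockwise walk around the grid from the top left corner, in coordinates (row,
  column). The gaps 0 and \<open>2 * (m + n)\<close> both lie at \<open>(0, 0)\<close>.\<close>

definition grid_pos :: "nat \<Rightarrow> nat \<Rightarrow> nat \<Rightarrow> nat \<times> nat" where
  "grid_pos m n p =
     (if p \<le> n then (0, p) else if p \<le> n + m then (p - n, n)
      else if p \<le> 2 * n + m then (m, 2 * n + m - p) else (2 * n + 2 * m - p, 0))"

lemma even_grid_pos:
  assumes "p \<le> 2 * (m + n)"
  shows "even (p + fst (grid_pos m n p) + snd (grid_pos m n p))"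
proof -
  consider "p \<le> n" | "n < p" "p \<le> n + m" | "n + m < p" "p \<le> 2 * n + m" | "2 * n + m < p"
    by linarith
  then show ?thesis
  proof cases
    case 1
    then show ?thesis
      by (simp add: grid_pos_def)
  next
    case 2
    then have "p + fst (grid_pos m n p) + snd (grid_pos m n p) = 2 * p"
      by (simp add: grid_pos_def)
    then show ?thesis
      by (simp only: dvd_triv_left)
  next
    case 3
    then have "p + fst (grid_pos m n p) + snd (grid_pos m n p) = 2 * (m + n)"
      by (simp add: grid_pos_def)
    then show ?thesis
      by (simp only: dvd_triv_left)
  next
    case 4
    then have "p + fst (grid_pos m n p) + snd (grid_pos m n p) = 2 * (m + n)"
      using assms by (simp add: grid_pos_def)
    then show ?thesis
      by (simp only: dvd_triv_left)
  qed
qed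

lemma catalan_lipschitz_boundary:
  assumes C: "C \<in> catalan_states m n" and d_h: "d_h m C \<le> n" and d_v: "d_v n C \<le> m"
  shows "lipschitz_boundary (marked_points m n) C (boundary_index m n) (2 * (m + n)) (grid_pos m n)"
proof -
  interpret noncrossing_matching "marked_points m n" C "boundary_index m n" "2 * (m + n)"
    by (rule catalan_noncrossing_matching[OF C])
  \<comment> \<open>The gaps \<open>j\<close> and \<open>2 * n + m - j\<close> lie at the opposite
    vertices \<open>(0, j)\<close> and \<open>(m, j)\<close>.\<close>
  have vertical: "separation j (2 * n + m - j) \<le> int m" if "j \<le> n" for j
  proof -
    \<comment> \<open>For \<open>j = 0\<close> and \<open>j = n\<close> the line is a side of the
      rectangle, which \<open>d_v\<close> does not cover; there the \<open>m\<close> marked points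
      on that side give the bound.\<close>
    consider "j = 0" | "j = n" | "1 \<le> j" "j \<le> n - 1"
      using \<open>j \<le> n\<close> by arith
    then show ?thesis
    proof cases
      case 1
      then show ?thesis
        using separation_triangle[of 0 "2 * n + m" "2 * (m + n)"] separation_N
          separation_le[of "2 * n + m" "2 * (m + n)"]
          separation_commute[of "2 * n + m" "2 * (m + n)"] by simp
    next
      case 2
      then show ?thesis
        using separation_le[of n "n + m"] by (simp add: mult_2)
    next
      case 3
      have "separation j (2 * n + m - j) = int (intersections (left_of_line j) C)"
        unfolding intersections_def
      proof (rule separation_line)
        show "left_of_line j x \<longleftrightarrow> \<not> (j < boundary_index m n x \<and> boundary_index m n x \<le> 2 * n + m - j)"
          if "x \<in> marked_points m n" for x
          using that 3 by (cases x) auto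
      qed (use 3 in simp)
      moreover have "intersections (left_of_line j) C \<le> d_v n C"
        unfolding d_v_def using 3 by (intro Max_ge) auto
      ultimately show ?thesis
        using d_v by simp
    qed
  qed
  have horizontal: "separation (n + i) (2 * n + 2 * m - i) \<le> int n" if "i \<le> m" for i
  proof -
    consider "i = 0" | "i = m" | "1 \<le> i" "i \<le> m - 1"
      using \<open>i \<le> m\<close> by arith
    then show ?thesis
    proof cases
      case 1
      then show ?thesis
        using separation_triangle[of n "2 * (m + n)" 0] separation_N
          separation_le[of 0 n] separation_commute[of n 0] by (simp add: add.commute)
    next
      case 2
      have "separation (n + m) (2 * n + m) \<le> int n"
        using separation_le[of "n + m" "2 * n + m"] by simp
      moreover have "2 * n + 2 * m - m = 2 * n + m"
        by simp
      ultimately show ?thesis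
        by (simp only: 2)
    next
      case 3
      have "separation (n + i) (2 * n + 2 * m - i) = int (intersections (above_line i) C)"
        unfolding intersections_def
      proof (rule separation_line)
        show "above_line i x \<longleftrightarrow> \<not> (n + i < boundary_index m n x
            \<and> boundary_index m n x \<le> 2 * n + 2 * m - i)"
          if "x \<in> marked_points m n" for x
          using that 3 by (cases x) auto
      qed (use 3 in simp)
      moreover have "intersections (above_line i) C \<le> d_h m C"
        unfolding d_h_def using 3 by (intro Max_ge) auto
      ultimately show ?thesis
        using d_h by simp
    qed
  qed
  have le: "separation p q \<le> grid_dist (grid_pos m n p) (grid_pos m n q)"
    if pq: "p \<le> q" "q \<le> 2 * (m + n)" for p q
  proof -
    have direct: "separation p q \<le> int q - int p"
      using separation_le[OF pq] .
    \<comment> \<open>On opposite sides, go straight across and then along the far side. In the last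
      three cases the boundary walk from \<open>p\<close> to \<open>q\<close> is already a shortest
      grid path.\<close>
    from pq consider (top_bottom) "p \<le> n" "n + m < q" "q \<le> 2 * n + m"
      | (top_left) "p \<le> n" "n + m < q" "2 * n + m < q"
      | (right_left) "n < p" "p \<le> n + m" "2 * n + m < q"
      | (near) "p \<le> n" "q \<le> n + m" | (right_bottom) "n < p" "p \<le> n + m" "q \<le> 2 * n + m"
      | (bottom_left) "n + m < p"
      by linarith
    then show ?thesis
    proof cases
      case top_bottom
      have "2 * n + m - p \<le> 2 * (m + n)"
        by simp
      from separation_le_abs[OF this pq(2)]
      have "separation p q \<le> int m + \<bar>int (2 * n + m - p) - int q\<bar>"
        using separation_triangle[of p q "2 * n + m - p"] vertical[OF top_bottom(1)]
        by linarith
      then show ?thesis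
        using top_bottom by (simp add: grid_pos_def grid_dist_def)
    next
      case top_left
      \<comment> \<open>The shortest path turns the top left corner, where the gaps 0 and
        \<open>2 * (m + n)\<close> are the same node.\<close>
      have "separation p q \<le> int p + (2 * (int m + int n) - int q)"
        using separation_triangle[of p q 0] separation_triangle[of 0 q "2 * (m + n)"] separation_N
          separation_le_abs[of p 0] separation_le_abs[of "2 * (m + n)" q] top_left pq by simp
      then show ?thesis
        using top_left pq by (simp add: grid_pos_def grid_dist_def)
    next
      case right_left
      have "2 * n + 2 * m - (p - n) \<le> 2 * (m + n)" "p - n \<le> m" "n + (p - n) = p"
        using right_left by simp_all
      from separation_le_abs[OF this(1) pq(2)] horizontal[OF this(2), unfolded this(3)]
      have "separation p q \<le> int n + \<bar>int (2 * n + 2 * m - (p - n)) - int q\<bar>"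
        using separation_triangle[of p q "2 * n + 2 * m - (p - n)"]
        by linarith
      then show ?thesis
        using right_left pq by (simp add: grid_pos_def grid_dist_def)
    next
      case near
      then show ?thesis
        using direct pq by (simp add: grid_pos_def grid_dist_def)
    next
      case right_bottom
      then show ?thesis
        using direct pq by (simp add: grid_pos_def grid_dist_def)
    next
      case bottom_left
      then show ?thesis
        using direct pq by (simp add: grid_pos_def grid_dist_def)
    qed
  qed
  show ?thesis
  proof
    show "separation p q \<le> grid_dist (grid_pos m n p) (grid_pos m n q)"
      if "p \<le> 2 * (m + n)" "q \<le> 2 * (m + n)" for p q
    proof (cases "p \<le> q")
      case True
      then show ?thesis
        using that by (intro le)
    next
      case False
      then show ?thesis
        using le[of q p] that unfolding separation_commute[of p q] grid_dist_commute[of "grid_pos m n p"]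
        by simp
    qed
    show "even (p + fst (grid_pos m n p) + snd (grid_pos m n p))" if "p \<le> 2 * (m + n)" for p
      using that by (rule even_grid_pos)
  qed
qed

section \<open>Strand labels and the Kauffman state\<close>

text \<open>
  The strand \<open>Vertical i j\<close> crosses the grid edge between \<open>(i, j - 1)\<close> and \<open>(i, j)\<close>, and
  \<open>Horizontal i j\<close> the one between \<open>(i - 1, j)\<close> and \<open>(i, j)\<close>.
\<close>

fun strand_label :: "(nat \<times> nat \<Rightarrow> 'a set) \<Rightarrow> strand \<Rightarrow> 'a set" where
  "strand_label \<phi> (Vertical i j) = sym_diff (\<phi> (i, j - 1)) (\<phi> (i, j))"
| "strand_label \<phi> (Horizontal i j) = sym_diff (\<phi> (i - 1, j)) (\<phi> (i, j))"

text \<open>The strand at \<open>x\<close> crosses the boundary edge between the gaps on both sides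
  of \<open>x\<close>. On the bottom and left sides the clockwise order runs against the
  coordinates, which the symmetric difference does not notice.\<close>

lemma strand_label_end_strand:
  assumes "m \<ge> 1" "n \<ge> 1" "x \<in> marked_points m n"
  shows "strand_label \<phi> (end_strand m n x)
    = sym_diff (\<phi> (grid_pos m n (boundary_index m n x - 1))) (\<phi> (grid_pos m n (boundary_index m n x)))"
proof (cases x)
  case (Top j)
  moreover have "grid_pos m n (j - 1) = (0, j - 1)" "grid_pos m n j = (0, j)"
    using assms Top by (auto simp: grid_pos_def)
  ultimately show ?thesis
    by simp
next
  case (Right i)
  moreover have "grid_pos m n (n + i - 1) = (i - 1, n)" "grid_pos m n (n + i) = (i, n)"
    using assms Right by (auto simp: grid_pos_def)
  ultimately show ?thesis
    by simp
next
  case (Bottom j)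
  moreover have "grid_pos m n (n + m + (n + 1 - j) - 1) = (m, j)"
      "grid_pos m n (n + m + (n + 1 - j)) = (m, j - 1)"
    using assms Bottom by (auto simp: grid_pos_def)
  ultimately show ?thesis
    by (simp add: Un_commute)
next
  case (Left i)
  moreover have "grid_pos m n (2 * n + m + (m + 1 - i) - 1) = (i, 0)"
      "grid_pos m n (2 * n + m + (m + 1 - i)) = (i - 1, 0)"
    using assms Left by (auto simp: grid_pos_def)
  ultimately show ?thesis
    by (simp add: Un_commute)
qed

theorem theorem2p5:
  fixes m n :: nat and C :: "point set set"
  assumes "m \<ge> 1" and "n \<ge> 1"
    and "C \<in> catalan_states m n"
    and "d_h m C \<le> n" and "d_v n C \<le> m"
  shows "\<exists>s\<in>kauffman_states m n. kauffman_diagram m n s = C"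
proof -
  interpret lipschitz_boundary "marked_points m n" C "boundary_index m n" "2 * (m + n)" "grid_pos m n"
    using catalan_lipschitz_boundary assms by blast
  \<comment> \<open>The positive smoothing cuts off the top right and bottom left corners of the
    unit square and leaves the other two connected, so it fits when these have equal regions.
    Otherwise \<open>region_square\<close> makes the regions of the first two equal.\<close>
  define s where "s = restrict
    (\<lambda>(i, j). if region (i - 1, j - 1) = region (i, j) then Positive else Negative) (crossings m n)"
  define R where "R = same_component m n s"
  have "s \<in> kauffman_states m n"
    by (simp add: s_def kauffman_states_def)
  \<comment> \<open>Joined strands cross two edges that share a corner, and the other ends of these
    edges have equal regions.\<close>
  have joined_label: "strand_label region x = strand_label region y" if xy: "(x, y) \<in> joined m n s" for x y
  proof -
    obtain i j where ij: "i \<ge> 1" "j \<ge> 1" "(i, j) \<in> crossings m n" "(x, y) \<in> smoothing (s (i, j)) (i, j)"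
      using xy by (auto simp: joined_def crossings_def)
    show ?thesis
    proof (cases "region (i - 1, j - 1) = region (i, j)")
      case True
      then have "s (i, j) = Positive"
        using ij(3) by (simp add: s_def)
      then show ?thesis
        using ij(4) True by auto
    next
      case False
      then have "s (i, j) = Negative"
        using ij(3) by (simp add: s_def)
      moreover have "region (i - 1, j) = region (i, j - 1)"
        using region_square[of "(i - 1, j - 1)" "(i - 1, j)" "(i, j)" "(i, j - 1)"] ij(1,2) False
        by (simp add: grid_dist_def)
      ultimately show ?thesis
        using ij(4) by auto
    qed
  qed
  have R_label: "strand_label region x = strand_label region y" if "(x, y) \<in> R" for x y
    using that unfolding R_def same_component_def
  proof (induction rule: rtrancl_induct)
    case (step y z)
    from step.hyps(2) have "strand_label region y = strand_label region z"
      using joined_label[of y z] joined_label[of z y] by (elim UnE converseE) simp_all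
    then show ?case
      using step.IH by simp
  qed simp
  \<comment> \<open>On the boundary \<open>region\<close> is \<open>arcs_over\<close>, which changes
    by exactly \<open>e\<close> at an end point of \<open>e\<close>.\<close>
  have end_label: "strand_label region (end_strand m n x) = {e}" if "e \<in> C" "x \<in> e" for e x
  proof -
    have x: "x \<in> marked_points m n"
      using that partition by (auto simp: partition_on_def)
    then have "boundary_index m n x \<le> 2 * (m + n)"
      using bij_betwE[OF bij_idx] by auto
    moreover from this have "boundary_index m n x - 1 \<le> 2 * (m + n)"
      by linarith
    ultimately show ?thesis
      unfolding strand_label_end_strand[OF assms(1,2) x] sym_diff_arcs_over_idx[OF that, symmetric]
      by (simp only: region_pos)
  qed
  \<comment> \<open>Otherwise the component of \<open>x\<close> would contain exactly one marked
    point, against \<open>even_card_ends\<close>.\<close>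
  have partner: "\<exists>y\<in>marked_points m n. y \<noteq> x \<and> (end_strand m n x, end_strand m n y) \<in> R"
    if x: "x \<in> marked_points m n" for x
  proof (rule ccontr)
    assume "\<not> ?thesis"
    then have "{y \<in> marked_points m n. end_strand m n y \<in> R `` {end_strand m n x}} = {x}"
      using x by (auto simp: R_def same_component_def)
    moreover have "even (card {y \<in> marked_points m n. end_strand m n y \<in> R `` {end_strand m n x}})"
    proof (rule even_card_ends)
      fix u v assume "(u, v) \<in> joined m n s"
      then show "u \<in> R `` {end_strand m n x} \<longleftrightarrow> v \<in> R `` {end_strand m n x}"
        unfolding R_def same_component_def Image_singleton_iff
        by (meson UnI1 UnI2 converseI rtrancl.rtrancl_into_rtrancl)
    qed
    ultimately show False
      by simp
  qed
  have arc: "{x, y} \<in> C" if xy: "x \<in> marked_points m n" "y \<in> marked_points m n" "x \<noteq> y"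
    "(end_strand m n x, end_strand m n y) \<in> R" for x y
  proof -
    have "x \<in> \<Union>C" "y \<in> \<Union>C"
      using xy(1,2) partition by (auto simp: partition_on_def)
    then obtain e f where ef: "e \<in> C" "x \<in> e" "f \<in> C" "y \<in> f"
      by blast
    \<comment> \<open>Labels are constant on components, so the arcs of \<open>C\<close> at
      \<open>x\<close> and at \<open>y\<close> coincide.\<close>
    then have "{e} = {f}"
      using end_label[of e x] end_label[of f y] R_label[OF xy(4)] by simp
    moreover have "card e = 2"
      using card_arc ef(1) .
    ultimately have "{x, y} = e"
      using ef xy(3) by (intro card_subset_eq) (auto intro: card_ge_0_finite)
    then show ?thesis
      using ef by simp
  qed
  have "kauffman_diagram m n s = C"
  proof
    show "kauffman_diagram m n s \<subseteq> C"
      using arc by (auto simp: kauffman_diagram_def R_def)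
    show "C \<subseteq> kauffman_diagram m n s"
    proof
      fix e assume e: "e \<in> C"
      then obtain x where x: "x \<in> e" "x \<in> marked_points m n"
        using arc_ends by blast
      obtain y where y: "y \<in> marked_points m n" "y \<noteq> x" "(end_strand m n x, end_strand m n y) \<in> R"
        using partner[OF x(2)] by blast
      have "e = {x, y}"
        using arc_unique[OF e arc[OF x(2) y(1) _ y(3)] x(1)] y(2) by simp
      then show "e \<in> kauffman_diagram m n s"
        using x(2) y unfolding kauffman_diagram_def R_def by blast
    qed
  qed
  then show ?thesis
    using \<open>s \<in> kauffman_states m n\<close> by blast
qed

end
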